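(* For $n\ge1$, the number of equivalence classes into which $S_n$ is partitioned under general $\{\{123,132,213\}\}$-equivalence is $2^{n-1}$.
   Context: Permutations are written as words $\pi_1\cdots\pi_n$. A sequence of distinct integers $a_1a_2a_3$ has pattern $\sigma\in S_3$ if $a_s<a_t\iff\sigma_s<\sigma_t$. A general move on $\pi\in S_n$ chooses any positions $i_1<i_2<i_3$ with $\pi_{i_1}\pi_{i_2}\pi_{i_3}$ of pattern $\sigma\in\{123,132,213\}$ and rearranges these three values in these positions to have a pattern $\sigma'\in\{123,132,213\}$. Equivalence is the equivalence relation generated by such moves. *)

theory Defs
  imports "HOL-Combinatorics.Multiset_Permutations"
begin

text \<open>A permutation in \<open>S\<^sub>n\<close> is the word \<open>[\<pi>\<^sub>1, \<dots>, \<pi>\<^sub>n]\<close> of its values; list positions are counted from 0.\<close>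

abbreviation Sym :: "nat \<Rightarrow> nat list set" where
  "Sym n \<equiv> permutations_of_set {1..n}"

definition has_pattern :: "nat list \<Rightarrow> nat list \<Rightarrow> bool" where
  "has_pattern a \<sigma> \<longleftrightarrow> distinct a \<and> length a = length \<sigma> \<and>
     (\<forall>s<length a. \<forall>t<length a. a ! s < a ! t \<longleftrightarrow> \<sigma> ! s < \<sigma> ! t)"

text \<open>\<open>P\<close> is a set of disjoint blocks of patterns in \<open>S\<^sub>3\<close>; a move replaces a pattern by one
  of the same block.\<close>

definition general_move :: "nat list set set \<Rightarrow> nat list \<Rightarrow> nat list \<Rightarrow> bool" where
  "general_move P p q \<longleftrightarrow>
     (\<exists>i j k a b c. i < j \<and> j < k \<and> k < length p \<and>
        {a, b, c} = {p ! i, p ! j, p ! k} \<and>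
        q = p[i := a, j := b, k := c] \<and>
        (\<exists>B\<in>P. \<exists>\<sigma>\<in>B. \<exists>\<sigma>'\<in>B.
           has_pattern [p ! i, p ! j, p ! k] \<sigma> \<and> has_pattern [a, b, c] \<sigma>'))"

definition general_equiv :: "nat list set set \<Rightarrow> nat \<Rightarrow> (nat list \<times> nat list) set" where
  "general_equiv P n =
     {(p, q). p \<in> Sym n \<and> q \<in> Sym n \<and> equivclp (general_move P) p q}"

end

theory Submission
  imports Defs
begin

text \<open>
  A cut of a word is a position at which every earlier letter exceeds every later one. In each of
  the patterns 123, 132 and 213 the first letter is smaller than the last, so no cut separates the
  three positions of a move, and moves preserve the set of cuts. Conversely, sorting an occurrence
  of 132 or 213 into 123 makes the word lexicographically smaller, so every class contains a
  permutation avoiding 132 and 213. In such a permutation every descent is a cut, hence its cuts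
  determine the relative order of any two letters, and so the permutation. Thus the classes
  correspond to the sets of cuts, and these are all the subsets of \<open>{1..<n}\<close>.
\<close>

section \<open>Cuts and their invariance under moves\<close>

abbreviation patterns_123_132_213 :: "nat list set set" where
  "patterns_123_132_213 \<equiv> {{[1,2,3], [1,3,2], [2,1,3]}}"

text \<open>A cut is recorded as the length of the prefix before it. The bounds keep both sides
  nonempty, so a word of length \<open>n\<close> has its cuts in \<open>{1..<n}\<close>.\<close>

definition cuts :: "nat list \<Rightarrow> nat set" where
  "cuts p = {c. 0 < c \<and> c < length p \<and> (\<forall>a<c. \<forall>b. c \<le> b \<and> b < length p \<longrightarrow> p ! b < p ! a)}"

lemma all_less_3: "(\<forall>s<3. P s) \<longleftrightarrow> P 0 \<and> P 1 \<and> P (2::nat)"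
  by (auto simp: less_Suc_eq eval_nat_numeral)

lemma has_pattern_3:
  "has_pattern [x, y, z] [1, 2, 3] \<longleftrightarrow> x < y \<and> y < z"
  "has_pattern [x, y, z] [1, 3, 2] \<longleftrightarrow> x < z \<and> z < y"
  "has_pattern [x, y, z] [2, 1, 3] \<longleftrightarrow> y < x \<and> x < z"
  unfolding has_pattern_def length_Cons list.size(3)
  by (auto simp: all_less_3 numeral_3_eq_3[symmetric])

lemma sort_move_iff:
  "general_move patterns_123_132_213 p q \<longleftrightarrow>
     (\<exists>i j k a b c. i < j \<and> j < k \<and> k < length p \<and>
        {a, b, c} = {p ! i, p ! j, p ! k} \<and> q = p[i := a, j := b, k := c] \<and>
        (p ! i < p ! j \<and> p ! j < p ! k \<or> p ! i < p ! k \<and> p ! k < p ! j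
          \<or> p ! j < p ! i \<and> p ! i < p ! k) \<and>
        (a < b \<and> b < c \<or> a < c \<and> c < b \<or> b < a \<and> a < c))"
  unfolding general_move_def
  by (simp add: has_pattern_3 conj_disj_distribL conj_disj_distribR disj_ac del: One_nat_def)

text \<open>Extracts what invariance needs, whichever patterns are involved: letters travel only
  within \<open>{i..k}\<close>, and the letter at \<open>i\<close> lies below the one at
  \<open>k\<close>.\<close>

lemma sort_moveE:
  assumes "general_move patterns_123_132_213 p q"
  obtains i k where "i < k" "k < length p" "p ! i < p ! k" "length q = length p"
    "\<And>a. a < length p \<Longrightarrow>
       \<exists>a'<length p. q ! a = p ! a' \<and> (a = a' \<or> {a, a'} \<subseteq> {i..k})"
proof -
  from assms obtain i j k a b c where ijk: "i < j" "j < k" "k < length p"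
    and abc: "{a, b, c} = {p ! i, p ! j, p ! k}" and q: "q = p[i := a, j := b, k := c]"
    and pk: "p ! i < p ! k"
    unfolding sort_move_iff by (elim exE conjE) (erule disjE; fastforce)
  have "\<exists>a'<length p. q ! m = p ! a' \<and> (m = a' \<or> {m, a'} \<subseteq> {i..k})" if "m < length p" for m
  proof (cases "m \<in> {i, j, k}")
    case True
    then have "q ! m \<in> {a, b, c}" using ijk by (auto simp: q)
    then obtain a' where "a' \<in> {i, j, k}" "q ! m = p ! a'" unfolding abc by blast
    then show ?thesis using True ijk by (intro exI[of _ a']) auto
  next
    case False
    then have "q ! m = p ! m" by (simp add: q)
    then show ?thesis using that by blast
  qed
  then show ?thesis using that[of i k] ijk pk by (simp add: q)
qed

text \<open>Writing the old letters back into the same three positions is again a move. Hence, for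
  cuts and for letters, one inclusion suffices.\<close>

lemma sort_move_sym:
  assumes "general_move patterns_123_132_213 p q"
  shows "general_move patterns_123_132_213 q p"
proof -
  from assms obtain i j k a b c where ijk: "i < j" "j < k" "k < length p"
    and abc: "{a, b, c} = {p ! i, p ! j, p ! k}" and q: "q = p[i := a, j := b, k := c]"
    and pat: "p ! i < p ! j \<and> p ! j < p ! k \<or> p ! i < p ! k \<and> p ! k < p ! j
          \<or> p ! j < p ! i \<and> p ! i < p ! k" "a < b \<and> b < c \<or> a < c \<and> c < b \<or> b < a \<and> a < c"
    unfolding sort_move_iff by blast
  have "p = q[i := p ! i, j := p ! j, k := p ! k]"
    using ijk by (auto simp: q list_eq_iff_nth_eq nth_list_update)
  moreover have "q ! i = a" "q ! j = b" "q ! k = c" "length q = length p"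
    using ijk by (auto simp: q)
  ultimately show ?thesis
    unfolding sort_move_iff using ijk abc pat by metis
qed

lemma cuts_subset_sort_move:
  assumes "general_move patterns_123_132_213 p q"
  shows "cuts p \<subseteq> cuts q"
proof
  fix c assume "c \<in> cuts p"
  then have c: "0 < c" "c < length p" "\<And>a b. a < c \<Longrightarrow> c \<le> b \<Longrightarrow> b < length p \<Longrightarrow> p ! b < p ! a"
    by (auto simp: cuts_def)
  from assms obtain i k where ik: "i < k" "k < length p" "p ! i < p ! k" "length q = length p"
    and *: "\<And>a. a < length p \<Longrightarrow>
       \<exists>a'<length p. q ! a = p ! a' \<and> (a = a' \<or> {a, a'} \<subseteq> {i..k})"
    by (metis sort_moveE)
  \<comment> \<open>A cut with \<open>i < c\<close> and \<open>c \<le> k\<close> would force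
    \<open>p ! k < p ! i\<close>. So all travelling letters stay on one side of
    \<open>c\<close>.\<close>
  have "c \<le> i \<or> k < c" using c(3)[of i k] ik by linarith
  then have **: "\<exists>a'<length p. q ! a = p ! a' \<and> (a' < c \<longleftrightarrow> a < c)" if "a < length p" for a
    using *[OF that] by force
  have "q ! b < q ! a" if ab: "a < c" "c \<le> b" "b < length p" for a b
    using **[of a] **[of b] c ab by (metis leD leI less_trans)
  then show "c \<in> cuts q" using c ik by (simp add: cuts_def)
qed

lemma cuts_sort_move: "general_move patterns_123_132_213 p q \<Longrightarrow> cuts p = cuts q"
  using cuts_subset_sort_move cuts_subset_sort_move[OF sort_move_sym] by (rule subset_antisym)

lemma set_subset_sort_move:
  assumes "general_move patterns_123_132_213 p q"
  shows "set q \<subseteq> set p"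
proof
  fix x assume "x \<in> set q"
  then show "x \<in> set p"
    using assms by (elim sort_moveE) (metis in_set_conv_nth)
qed

text \<open>Distinctness of \<open>q\<close> comes from counting: it has the same letters and the
  same length as the distinct word \<open>p\<close>.\<close>

lemma sort_move_Sym:
  assumes "general_move patterns_123_132_213 p q" "p \<in> Sym n"
  shows "q \<in> Sym n"
proof -
  have "set q = set p"
    using set_subset_sort_move[OF assms(1)] set_subset_sort_move[OF sort_move_sym[OF assms(1)]]
    by blast
  moreover have "length q = length p" using assms(1) by (elim sort_moveE)
  ultimately show ?thesis using assms(2)
    by (metis card_distinct distinct_card permutations_of_setD permutations_of_setI)
qed

lemma cuts_equivclp:
  assumes "equivclp (general_move patterns_123_132_213) p q"
  shows "cuts p = cuts q"
  using assms
proof (induction rule: equivclp_induct)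
  case (step y z)
  then show ?case using cuts_sort_move[of y z] cuts_sort_move[of z y] by argo
qed simp

section \<open>Permutations avoiding 132 and 213\<close>

definition avoids_132_213 :: "nat list \<Rightarrow> bool" where
  "avoids_132_213 p \<longleftrightarrow> (\<forall>i j k. i < j \<and> j < k \<and> k < length p \<longrightarrow>
     \<not> (p ! i < p ! k \<and> p ! k < p ! j) \<and> \<not> (p ! j < p ! i \<and> p ! i < p ! k))"

text \<open>The two words agree before position \<open>j\<close>, where the new letter is
  smaller.\<close>

lemma swap_descent_lex:
  assumes "j < k" "k < length p" "p ! k < (p ! j :: nat)"
  shows "(p[j := p ! k, k := p ! j], p) \<in> lex less_than"
proof -
  let ?q = "p[j := p ! k, k := p ! j]"
  have "p = take j p @ p ! j # drop (Suc j) p"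
    using assms by (simp add: id_take_nth_drop)
  moreover have "?q = take j p @ p ! k # drop (Suc j) ?q"
    using id_take_nth_drop[of j ?q] assms by simp
  ultimately show ?thesis
    unfolding lex_conv using assms by force
qed

text \<open>Well-founded induction on the lexicographic order: 132 becomes 123 by exchanging its
  last two letters, 213 by exchanging its first two, and each exchange removes a descent.\<close>

lemma ex_avoids_132_213_equivclp:
  "p \<in> Sym n \<Longrightarrow> \<exists>q\<in>Sym n. avoids_132_213 q \<and> equivclp (general_move patterns_123_132_213) p q"
proof (induction p rule: wf_induct_rule[OF wf_lex[OF wf_less_than]])
  case (1 p)
  show ?case
  proof (cases "avoids_132_213 p")
    case True
    then show ?thesis using 1(2) equivclp_refl by (intro bexI[of _ p] conjI)
  next
    case False
    then obtain i j k where ijk: "i < j" "j < k" "k < length p"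
      and pat: "p ! i < p ! k \<and> p ! k < p ! j \<or> p ! j < p ! i \<and> p ! i < p ! k"
      unfolding avoids_132_213_def by blast
    obtain q where q: "general_move patterns_123_132_213 p q" "(q, p) \<in> lex less_than"
      using pat
    proof
      assume *: "p ! i < p ! k \<and> p ! k < p ! j"
      have "general_move patterns_123_132_213 p (p[j := p ! k, k := p ! j])"
        unfolding sort_move_iff
        by (rule exI[of _ i], rule exI[of _ j], rule exI[of _ k], rule exI[of _ "p ! i"],
            rule exI[of _ "p ! k"], rule exI[of _ "p ! j"]) (use * ijk in auto)
      then show thesis using that swap_descent_lex[of j k p] * ijk by blast
    next
      assume *: "p ! j < p ! i \<and> p ! i < p ! k"
      have "general_move patterns_123_132_213 p (p[i := p ! j, j := p ! i])"
        unfolding sort_move_iff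
        by (rule exI[of _ i], rule exI[of _ j], rule exI[of _ k], rule exI[of _ "p ! j"],
            rule exI[of _ "p ! i"], rule exI[of _ "p ! k"])
          (use * ijk in \<open>auto simp: list_eq_iff_nth_eq nth_list_update\<close>)
      then show thesis using that swap_descent_lex[of i j p] * ijk by force
    qed
    then obtain r where "r \<in> Sym n" "avoids_132_213 r" "equivclp (general_move patterns_123_132_213) q r"
      using 1(1)[OF q(2) sort_move_Sym[OF q(1) 1(2)]] by blast
    then show ?thesis using equivclp_trans[OF r_into_equivclp[of _ p q]] q(1) by blast
  qed
qed

text \<open>Avoiding 132 puts every letter before the bottom \<open>p ! Suc d\<close> of the descent
  above that bottom. If such a letter were smaller than one after the bottom, the three would form
  213.\<close>

lemma descent_in_cuts:
  assumes "distinct p" "avoids_132_213 p" "Suc d < length p" "p ! Suc d < p ! d"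
  shows "Suc d \<in> cuts p"
proof -
  have so: "\<not> (p ! i < p ! k \<and> p ! k < p ! j)" "\<not> (p ! j < p ! i \<and> p ! i < p ! k)"
    if "i < j" "j < k" "k < length p" for i j k
    using assms(2) that by (auto simp: avoids_132_213_def)
  have "p ! b < p ! a" if ab: "a < Suc d" "Suc d \<le> b" "b < length p" for a b
  proof -
    have ne: "p ! x \<noteq> p ! y" if "x < y" "y < length p" for x y
      using assms(1) that by (simp add: nth_eq_iff_index_eq)
    have 1: "p ! Suc d < p ! a"
      using so(1)[of a d "Suc d"] ne[of a "Suc d"] assms ab by (cases "a = d") auto
    have 2: "p ! b < p ! d"
      using so(2)[of d "Suc d" b] ne[of d b] assms ab by (cases "b = Suc d") auto
    show ?thesis
    proof (cases "b = Suc d")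
      case False
      then show ?thesis using so(2)[of a "Suc d" b] ne[of a b] 1 ab by linarith
    qed (use 1 in simp)
  qed
  then show ?thesis using assms by (simp add: cuts_def)
qed

text \<open>A cut between the positions forces a descent from \<open>i\<close> to \<open>j\<close>.
  Without one, all adjacent steps from \<open>i\<close> to \<open>j\<close> are ascents, and these
  chain together.\<close>

lemma avoids_132_213_less_iff:
  assumes "distinct p" "avoids_132_213 p" "i < j" "j < length p"
  shows "p ! i < p ! j \<longleftrightarrow> (\<forall>c\<in>cuts p. \<not> (i < c \<and> c \<le> j))"
proof
  assume "p ! i < p ! j"
  then show "\<forall>c\<in>cuts p. \<not> (i < c \<and> c \<le> j)"
    using assms by (force simp: cuts_def)
next
  assume *: "\<forall>c\<in>cuts p. \<not> (i < c \<and> c \<le> j)"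
  have "p ! m < p ! Suc m" if "i \<le> m" "m < j" for m
  proof (rule ccontr)
    assume "\<not> p ! m < p ! Suc m"
    moreover have "p ! m \<noteq> p ! Suc m"
      using assms that by (simp add: nth_eq_iff_index_eq)
    ultimately have "Suc m \<in> cuts p" using descent_in_cuts assms that by simp
    then show False using * that by auto
  qed
  then have "i < m \<Longrightarrow> m \<le> j \<Longrightarrow> p ! i < p ! m" for m
    by (induction m) (force simp: less_Suc_eq_le le_less)+
  then show "p ! i < p ! j" using \<open>i < j\<close> by simp
qed

section \<open>Reconstructing a permutation from its cuts\<close>

lemma Sym_D:
  assumes "p \<in> Sym n"
  shows "set p = {1..n}" "distinct p" "length p = n"
  using assms by (auto simp: permutations_of_set_def dest: distinct_card)

text \<open>The letters are exactly \<open>1\<close> to \<open>n\<close>, so each letter equals its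
  rank. Relative order therefore determines the word.\<close>

lemma Sym_nth_eq_card:
  assumes "p \<in> Sym n" "i < n"
  shows "p ! i = card {j. j < n \<and> p ! j \<le> p ! i}"
proof -
  note p = Sym_D[OF assms(1)]
  have "p ! i \<le> n" using p assms(2) nth_mem[of i p] by simp
  have "(!) p ` {j. j < n \<and> p ! j \<le> p ! i} = {x \<in> set p. x \<le> p ! i}"
    using p by (auto simp: set_conv_nth)
  also have "\<dots> = {1..p ! i}" using p \<open>p ! i \<le> n\<close> by auto
  finally have "card ((!) p ` {j. j < n \<and> p ! j \<le> p ! i}) = p ! i" by simp
  moreover have "inj_on ((!) p) {j. j < n \<and> p ! j \<le> p ! i}"
    using p by (auto simp: inj_on_def nth_eq_iff_index_eq)
  ultimately show ?thesis by (simp add: card_image)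
qed

lemma Sym_eqI:
  assumes "p \<in> Sym n" "q \<in> Sym n"
    and "\<And>i j. i < j \<Longrightarrow> j < n \<Longrightarrow> p ! i < p ! j \<longleftrightarrow> q ! i < q ! j"
  shows "p = q"
proof (rule nth_equalityI)
  show "length p = length q" using assms by (simp add: Sym_D)
next
  fix i assume "i < length p"
  then have i: "i < n" using assms by (simp add: Sym_D)
  have "p ! j \<le> p ! i \<longleftrightarrow> q ! j \<le> q ! i" if "j < n" for j
  proof (cases i j rule: linorder_cases)
    case less
    then show ?thesis using assms(3)[OF less that] by (simp add: not_less flip: not_le)
  next
    case greater
    have "p ! j \<noteq> p ! i" "q ! j \<noteq> q ! i"
      using greater i Sym_D[OF assms(1)] Sym_D[OF assms(2)] by (auto simp: nth_eq_iff_index_eq)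
    then show ?thesis using assms(3)[OF greater i] by (simp add: le_less)
  qed simp
  then have "{j. j < n \<and> p ! j \<le> p ! i} = {j. j < n \<and> q ! j \<le> q ! i}" by blast
  then show "p ! i = q ! i"
    using Sym_nth_eq_card[OF assms(1) i] Sym_nth_eq_card[OF assms(2) i] by simp
qed

lemma avoids_132_213_eqI:
  assumes "p \<in> Sym n" "q \<in> Sym n" "avoids_132_213 p" "avoids_132_213 q" "cuts p = cuts q"
  shows "p = q"
  using assms(1,2)
proof (rule Sym_eqI)
  fix i j assume "i < j" "j < n"
  then show "p ! i < p ! j \<longleftrightarrow> q ! i < q ! j"
    using assms Sym_D[OF assms(1)] Sym_D[OF assms(2)] by (simp add: avoids_132_213_less_iff)
qed

section \<open>Counting classes by sets of cuts\<close>

lemma general_equiv_eq_cuts: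
  "general_equiv patterns_123_132_213 n = {(p, q). p \<in> Sym n \<and> q \<in> Sym n \<and> cuts p = cuts q}"
proof -
  have "equivclp (general_move patterns_123_132_213) p q"
    if pq: "p \<in> Sym n" "q \<in> Sym n" "cuts p = cuts q" for p q
  proof -
    obtain p' where p': "p' \<in> Sym n" "avoids_132_213 p'" "equivclp (general_move patterns_123_132_213) p p'"
      using ex_avoids_132_213_equivclp pq(1) by blast
    obtain q' where q': "q' \<in> Sym n" "avoids_132_213 q'" "equivclp (general_move patterns_123_132_213) q q'"
      using ex_avoids_132_213_equivclp pq(2) by blast
    \<comment> \<open>Reduction preserves cuts, so the two avoiders share their cuts and coincide;
      this common word links \<open>p\<close> to \<open>q\<close>.\<close>
    have "p' = q'"
      using p' q' pq(3) cuts_equivclp by (intro avoids_132_213_eqI) auto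
    then show ?thesis using equivclp_trans[OF p'(3)] equivclp_sym[OF q'(3)] by simp
  qed
  then show ?thesis unfolding general_equiv_def using cuts_equivclp by blast
qed

text \<open>Induction splitting off the largest cut \<open>k\<close>: a word \<open>w\<close> of
  length \<open>k\<close> realizing the other cuts is raised by \<open>m = n - k\<close> and
  followed by the increasing word from 1 to \<open>m\<close>. The increasing word itself serves the
  empty set.\<close>

lemma ex_Sym_cuts_eq:
  "S \<subseteq> {1..<n} \<Longrightarrow> \<exists>p\<in>Sym n. cuts p = S"
proof (induction n arbitrary: S rule: less_induct)
  case (less n)
  show ?case
  proof (cases "S = {}")
    case True
    have "[1..<Suc n] \<in> Sym n" by (auto simp: permutations_of_set_def)
    moreover have "c \<notin> cuts [1..<Suc n]" for c
    proof
      assume "c \<in> cuts [1..<Suc n]"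
      then have "0 < c" "c < n" "[1..<Suc n] ! c < [1..<Suc n] ! 0"
        by (auto simp: cuts_def simp del: upt_Suc)
      then show False by (simp del: upt_Suc)
    qed
    ultimately show ?thesis using True by blast
  next
    case False
    define k where "k = Max S"
    define m where "m = n - k"
    have fin: "finite S" using less.prems finite_subset by blast
    have k: "k \<in> S" "\<And>s. s \<in> S \<Longrightarrow> s \<le> k" using False fin by (auto simp: k_def)
    have kn: "0 < k" "k < n" using k less.prems by auto
    have "S - {k} \<subseteq> {1..<k}" using k less.prems by (force simp: le_less)
    then obtain w where w: "w \<in> Sym k" "cuts w = S - {k}" using less.IH kn by blast
    note wD = Sym_D[OF w(1)]
    define p where "p = map ((+) m) w @ [1..<Suc m]"
    have len: "length p = n" using kn wD by (simp add: p_def m_def)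
    have p1: "p ! a = m + w ! a" if "a < k" for a using that wD by (simp add: p_def nth_append)
    have p2: "p ! b = Suc (b - k)" if "k \<le> b" "b < n" for b
      using that wD by (simp add: p_def nth_append m_def del: upt_Suc)
    \<comment> \<open>Positivity makes every raised letter exceed \<open>m\<close>, the largest
      letter of the tail.\<close>
    have wpos: "0 < w ! a" if "a < k" for a using that wD nth_mem[of a w] by simp
    have "n = m + k" using kn by (simp add: m_def)
    then have "set p = {1..n}"
      using wD by (auto simp: p_def image_add_atLeastAtMost simp del: upt_Suc)
    moreover have "distinct p" using wD by (auto simp: p_def distinct_map simp del: upt_Suc)
    ultimately have "p \<in> Sym n" by (auto simp: permutations_of_set_def)
    moreover have "c \<in> cuts p \<longleftrightarrow> c \<in> S" for c
    proof (cases c k rule: linorder_cases)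
      case less
      \<comment> \<open>Before \<open>k\<close>, comparisons with the tail hold automatically, so
        only those inside \<open>w\<close> matter.\<close>
      have "(\<forall>a<c. \<forall>b. c \<le> b \<and> b < n \<longrightarrow> p ! b < p ! a) \<longleftrightarrow>
            (\<forall>a<c. \<forall>b. c \<le> b \<and> b < k \<longrightarrow> w ! b < w ! a)" (is "?L \<longleftrightarrow> ?R")
      proof
        assume L: ?L
        show ?R
        proof (intro allI impI)
          fix a b assume "a < c" "c \<le> b \<and> b < k"
          then show "w ! b < w ! a" using L[rule_format, of a b] less kn by (simp add: p1)
        qed
      next
        assume R: ?R
        show ?L
        proof (intro allI impI)
          fix a b assume ab: "a < c" "c \<le> b \<and> b < n"
          show "p ! b < p ! a"
          proof (cases "b < k")
            case True
            then show ?thesis using R[rule_format, of a b] less ab by (simp add: p1)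
          next
            case False
            then show ?thesis using ab less kn wpos[of a] by (simp add: p1 p2 m_def)
          qed
        qed
      qed
      then have "c \<in> cuts p \<longleftrightarrow> c \<in> cuts w"
        using less kn wD len by (simp add: cuts_def)
      then show ?thesis using w less by auto
    next
      case equal
      have "p ! b < p ! a" if "a < k" "k \<le> b" "b < n" for a b
        using that wpos[of a] kn by (simp add: p1 p2 m_def)
      then show ?thesis using equal k kn len by (simp add: cuts_def)
    next
      case greater
      have "c \<notin> cuts p"
      proof
        assume "c \<in> cuts p"
        \<comment> \<open>Positions \<open>k\<close> and \<open>c\<close> both lie in the increasing
          tail, so no cut can separate them.\<close>
        then have "c < n" "p ! c < p ! k" using greater len by (auto simp: cuts_def)
        then show False using greater by (simp add: p2)
      qed
      then show ?thesis using k(2)[of c] greater by auto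
    qed
    ultimately show ?thesis by blast
  qed
qed

lemma cuts_image_Sym: "cuts ` Sym n = Pow {1..<n}"
proof
  show "cuts ` Sym n \<subseteq> Pow {1..<n}" by (auto simp: cuts_def Sym_D)
  show "Pow {1..<n} \<subseteq> cuts ` Sym n" using ex_Sym_cuts_eq by blast
qed

text \<open>The classes are the fibres of \<open>f\<close> over attained values; such fibres are
  nonempty, so distinct values give distinct classes.\<close>

lemma card_quotient_kernel:
  "card (A // {(x, y). x \<in> A \<and> y \<in> A \<and> f x = f y}) = card (f ` A)"
proof -
  let ?F = "\<lambda>v. {y \<in> A. v = f y}"
  have "A // {(x, y). x \<in> A \<and> y \<in> A \<and> f x = f y} = ?F ` f ` A"
    unfolding quotient_def by (auto simp: image_iff)
  moreover have "inj_on ?F (f ` A)" by (rule inj_onI) blast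
  ultimately show ?thesis by (simp add: card_image)
qed

theorem theorem2p8:
  fixes n :: nat
  assumes "n \<ge> 1"
  shows "card (Sym n // general_equiv {{[1,2,3], [1,3,2], [2,1,3]}} n) = 2 ^ (n - 1)"
  unfolding general_equiv_eq_cuts card_quotient_kernel cuts_image_Sym by (simp add: card_Pow)

end
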